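(* Let $k\ge1$ and $N\ge0$. For $1\le i\le k$, $$\overline{\mathcal E}_{k,i}(N)=a^Nq^{\binom{N+1}{2}}(-1/a)_N\sum_{n=-N}^{N}(-1)^n\frac{q^{kn^2+n(k-i)-\binom{n}{2}}}{(q)_{N-n}(q)_{N+n}},$$ and for $0\le i<k$, $$\overline{\Gamma}_{k,i}(N)=a^Nq^{\binom{N}{2}}(-1/a)_N\sum_{n=-N}^{N-1}(-1)^n\frac{q^{kn^2+n(k-i)-\binom{n+1}{2}}}{(q)_{N-n-1}(q)_{N+n}}.$$
   Context: $(x)_n=\prod_{m=0}^{n-1}(1-xq^m)$ for $n\ge0$; $\binom{n}{2}=n(n-1)/2$ for all integers $n$. Lattice paths: paths in the first quadrant starting on the $y$-axis, ending on the $x$-axis, using unit steps North-East $(x,y)\to(x+1,y+1)$, South-East $(x,y)\to(x+1,y-1)$, South $(x,y)\to(x,y-1)$, East $(x,0)\to(x+1,0)$ (East steps only at height 0). A South step may only occur immediately after a North-East step. A path is either empty or ends with a South-East or South step. Special $(k,i)$-conditions: start at $(0,k-i)$, all vertices have $y$-coordinate $<k$. A peak is a vertex preceded by a North-East step and followed by a South or South-East step; the major index $\mathrm{maj}(P)$ is the sum of the $x$-coordinates of the peaks; $s(P)$ is the number of South steps. $\overline{\mathcal E}_{k,i}(N)=\sum_P q^{\mathrm{maj}(P)}a^{s(P)}$ over paths $P$ satisfying the special $(k,i)$-conditions with exactly $N$ peaks. For $0\le i<k$, $\overline{\Gamma}_{k,i}(N)=\sum_P q^{\mathrm{maj}(P)-N}a^{s(P)}$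 over paths $P$ satisfying the special $(k,i+1)$-conditions with exactly $N$ peaks whose first step is North-East. *)

theory Defs
  imports "HOL-Computational_Algebra.Formal_Laurent_Series"
begin

text \<open>
  Generating functions are formal Laurent series in \<open>q\<close> over a field containing a nonzero element
  \<open>a\<close>. The case of an indeterminate \<open>a\<close> is obtained by taking a field of rational functions in \<open>a\<close>.
\<close>

abbreviation q :: "'a::field fls" where "q \<equiv> fls_X"

definition qpoch :: "'a::field fls \<Rightarrow> nat \<Rightarrow> 'a fls" where
  "qpoch x n = (\<Prod>m<n. 1 - x * q ^ m)"

definition binom2 :: "int \<Rightarrow> int" where
  "binom2 n = n * (n - 1) div 2"


datatype step = NorthEast | SouthEast | South | East

fun dx :: "step \<Rightarrow> nat" where
  "dx NorthEast = 1" | "dx SouthEast = 1" | "dx South = 0" | "dx East = 1"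

fun dy :: "step \<Rightarrow> int" where
  "dy NorthEast = 1" | "dy SouthEast = - 1" | "dy South = - 1" | "dy East = 0"

text \<open>
  The pair \<open>(h, ss)\<close> is the path that starts at \<open>(0, h)\<close> and takes the steps \<open>ss\<close>; its \<open>j\<close>-th vertex,
  \<open>j \<le> length ss\<close>, is \<open>(vx P j, vy P j)\<close>.
\<close>

type_synonym path = "int \<times> step list"

definition vx :: "path \<Rightarrow> nat \<Rightarrow> nat" where
  "vx P j = (\<Sum>s\<leftarrow>take j (snd P). dx s)"

definition vy :: "path \<Rightarrow> nat \<Rightarrow> int" where
  "vy P j = fst P + (\<Sum>s\<leftarrow>take j (snd P). dy s)"

definition lattice_path :: "path \<Rightarrow> bool" where
  "lattice_path P \<longleftrightarrow>
     (let ss = snd P in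
       (\<forall>j\<le>length ss. 0 \<le> vy P j) \<and>
       vy P (length ss) = 0 \<and>
       (\<forall>j<length ss. ss ! j = East \<longrightarrow> vy P j = 0) \<and>
       (\<forall>j<length ss. ss ! j = South \<longrightarrow> 0 < j \<and> ss ! (j - 1) = NorthEast) \<and>
       (ss = [] \<or> last ss = SouthEast \<or> last ss = South))"

definition special :: "nat \<Rightarrow> nat \<Rightarrow> path \<Rightarrow> bool" where
  "special k i P \<longleftrightarrow>
     lattice_path P \<and> fst P = int k - int i \<and> (\<forall>j\<le>length (snd P). vy P j < int k)"

definition peaks :: "path \<Rightarrow> nat set" where
  "peaks P = {j. 0 < j \<and> j < length (snd P) \<and> snd P ! (j - 1) = NorthEast \<and>
                 (snd P ! j = South \<or> snd P ! j = SouthEast)}"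

definition maj :: "path \<Rightarrow> nat" where
  "maj P = (\<Sum>j\<in>peaks P. vx P j)"

definition souths :: "path \<Rightarrow> nat" where
  "souths P = length (filter (\<lambda>s. s = South) (snd P))"

definition path_gf :: "'a::field \<Rightarrow> path set \<Rightarrow> 'a fls" where
  "path_gf a A = fps_to_fls (Abs_fps (\<lambda>m. \<Sum>P\<in>{P\<in>A. maj P = m}. a ^ souths P))"

definition E_bar :: "'a::field \<Rightarrow> nat \<Rightarrow> nat \<Rightarrow> nat \<Rightarrow> 'a fls" where
  "E_bar a k i N = path_gf a {P. special k i P \<and> card (peaks P) = N}"

definition Gamma_bar :: "'a::field \<Rightarrow> nat \<Rightarrow> nat \<Rightarrow> nat \<Rightarrow> 'a fls" where
  "Gamma_bar a k i N =
     q powi (- int N) *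
     path_gf a {P. special k (i + 1) P \<and> card (peaks P) = N \<and>
                   snd P \<noteq> [] \<and> hd (snd P) = NorthEast}"


text \<open>
  Only finitely many special paths have a given major index, so the coefficients
  in \<^const>\<open>path_gf\<close> are sums over finite sets.
\<close>

lemma finite_peaks: "finite (peaks P)"
  by (rule finite_subset[of _ "{..<length (snd P)}"]) (auto simp: peaks_def)

lemma sum_dy_le:
  assumes "NorthEast \<notin> set vs"
  shows "(\<Sum>s\<leftarrow>vs. dy s) \<le> 0"
  using assms
proof (induction vs)
  case (Cons s vs)
  then show ?case by (cases s) auto
qed simp

lemma sum_dy_eq:
  assumes "NorthEast \<notin> set vs" "East \<notin> set vs"
  shows "(\<Sum>s\<leftarrow>vs. dy s) = - int (length vs)"
  using assms
proof (induction vs)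
  case (Cons s vs)
  then show ?case by (cases s) auto
qed simp

lemma length_le_sum_dx:
  "length us \<le> (\<Sum>s\<leftarrow>us. dx s) + length (filter (\<lambda>s. s = South) us)"
proof (induction us)
  case (Cons s us)
  then show ?case by (cases s) auto
qed simp

lemma count_NorthEast_le_sum_dx:
  "length (filter (\<lambda>s. s = NorthEast) us) \<le> (\<Sum>s\<leftarrow>us. dx s)"
proof (induction us)
  case (Cons s us)
  then show ?case by (cases s) auto
qed simp

lemma count_South_le_count_NorthEast:
  assumes "\<forall>j<length us. us ! j = South \<longrightarrow> 0 < j \<and> us ! (j - 1) = NorthEast"
  shows "length (filter (\<lambda>s. s = South) us) \<le> length (filter (\<lambda>s. s = NorthEast) us)"
proof -
  have "card {j. j < length us \<and> us ! j = South} \<le> card {j. j < length us \<and> us ! j = NorthEast}"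
  proof (rule card_inj_on_le[where f = "\<lambda>j. j - 1"])
    show "inj_on (\<lambda>j. j - 1) {j. j < length us \<and> us ! j = South}"
    proof (rule inj_onI)
      fix x y
      assume "x \<in> {j. j < length us \<and> us ! j = South}" "y \<in> {j. j < length us \<and> us ! j = South}"
        and e: "x - 1 = y - 1"
      then have "0 < x" "0 < y" using assms by auto
      with e show "x = y" by simp
    qed
    show "(\<lambda>j. j - 1) ` {j. j < length us \<and> us ! j = South} \<subseteq>
          {j. j < length us \<and> us ! j = NorthEast}"
      using assms by auto
  qed auto
  then show ?thesis by (simp add: length_filter_conv_card)
qed

lemma special_length_le:
  assumes sp: "special k i P"
  shows "length (snd P) \<le> 2 * maj P + k"
proof -
  obtain h ss where P: "P = (h, ss)" by (cases P)
  define vs where "vs = rev (takeWhile (\<lambda>s. s \<noteq> NorthEast) (rev ss))"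
  define us where "us = rev (dropWhile (\<lambda>s. s \<noteq> NorthEast) (rev ss))"
  have ss: "ss = us @ vs"
    unfolding us_def vs_def by (metis rev_append rev_rev_ident takeWhile_dropWhile_id)
  have vsN: "NorthEast \<notin> set vs"
    unfolding vs_def by (auto dest: set_takeWhileD)
  have usL: "last us = NorthEast" if "us \<noteq> []"
    using that hd_dropWhile[of "\<lambda>s. s \<noteq> NorthEast" "rev ss"]
    unfolding us_def by (simp add: last_rev)
  have yend: "vy P (length ss) = 0"
    and E: "\<And>j. j < length ss \<Longrightarrow> ss ! j = East \<Longrightarrow> vy P j = 0"
    and S: "\<And>j. j < length ss \<Longrightarrow> ss ! j = South \<Longrightarrow> 0 < j \<and> ss ! (j - 1) = NorthEast"
    and L: "ss = [] \<or> last ss = SouthEast \<or> last ss = South"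
    and K: "\<And>j. j \<le> length ss \<Longrightarrow> vy P j < int k"
    using sp by (auto simp: special_def lattice_path_def P Let_def)
  have vsE: "East \<notin> set vs"
  proof
    assume "East \<in> set vs"
    then obtain xs ys where v: "vs = xs @ East # ys" by (meson split_list)
    define j where "j = length us + length xs"
    have "vy P j = 0"
      using E[of j] by (simp add: ss v j_def nth_append)
    moreover have "vy P (length ss) = vy P j + (\<Sum>s\<leftarrow>ys. dy s)"
      by (simp add: vy_def P ss v j_def)
    ultimately have s0: "(\<Sum>s\<leftarrow>ys. dy s) = 0" using yend by simp
    have "last ss = last (East # ys)" by (simp add: ss v)
    with L have ne: "ys \<noteq> []" and l: "last ys = SouthEast \<or> last ys = South"
      by (auto simp: ss v split: if_splits)
    have "NorthEast \<notin> set (butlast ys)"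
      using vsN v by (auto dest: in_set_butlastD)
    then have "(\<Sum>s\<leftarrow>butlast ys. dy s) \<le> 0" by (rule sum_dy_le)
    moreover have "(\<Sum>s\<leftarrow>ys. dy s) = (\<Sum>s\<leftarrow>butlast ys. dy s) + dy (last ys)"
    proof -
      have "(\<Sum>s\<leftarrow>butlast ys @ [last ys]. dy s) = (\<Sum>s\<leftarrow>butlast ys. dy s) + dy (last ys)"
        by simp
      then show ?thesis using ne by simp
    qed
    ultimately show False using s0 l by auto
  qed
  have "vy P (length ss) = vy P (length us) + (\<Sum>s\<leftarrow>vs. dy s)"
    by (simp add: vy_def P ss)
  then have "int (length vs) = vy P (length us)"
    using yend sum_dy_eq[OF vsN vsE] by simp
  moreover have "vy P (length us) < int k" by (rule K) (simp add: ss)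
  ultimately have lv: "length vs \<le> k" by simp
  have lu: "length us \<le> 2 * maj P"
  proof (cases "us = []")
    case False
    have "vs \<noteq> []"
      using usL[OF False] L False by (auto simp: ss)
    then obtain v vs' where v: "vs = v # vs'" by (cases vs) auto
    have "v = South \<or> v = SouthEast" using vsN vsE v by (cases v) auto
    moreover have "us ! (length us - 1) = NorthEast"
      using usL[OF False] False by (simp add: last_conv_nth)
    ultimately have "length us \<in> peaks P"
      using False by (simp add: peaks_def P ss v nth_append)
    then have "vx P (length us) \<le> maj P"
      unfolding maj_def by (intro member_le_sum) (auto simp: finite_peaks)
    then have m: "(\<Sum>s\<leftarrow>us. dx s) \<le> maj P" by (simp add: vx_def P ss)
    have "\<forall>j<length us. us ! j = South \<longrightarrow> 0 < j \<and> us ! (j - 1) = NorthEast"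
    proof (intro allI impI)
      fix j assume j: "j < length us" "us ! j = South"
      then show "0 < j \<and> us ! (j - 1) = NorthEast"
        using S[of j] by (simp add: ss nth_append less_imp_diff_less)
    qed
    from count_South_le_count_NorthEast[OF this] show ?thesis
      using length_le_sum_dx[of us] count_NorthEast_le_sum_dx[of us] m by linarith
  qed simp
  show ?thesis using lv lu by (simp add: P ss)
qed

lemma finite_special_maj: "finite {P. special k i P \<and> maj P = m}"
proof (rule finite_subset)
  have "x \<in> {NorthEast, SouthEast, South, East}" for x by (cases x) auto
  then have "UNIV = {NorthEast, SouthEast, South, East}" by blast
  then have "finite (UNIV :: step set)" by (metis finite.emptyI finite.insertI)
  then have "finite {ss :: step list. set ss \<subseteq> UNIV \<and> length ss \<le> 2 * m + k}"
    by (rule finite_lists_length_le)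
  then show "finite ({int k - int i} \<times> {ss :: step list. set ss \<subseteq> UNIV \<and> length ss \<le> 2 * m + k})"
    by simp
  show "{P. special k i P \<and> maj P = m} \<subseteq>
        {int k - int i} \<times> {ss. set ss \<subseteq> UNIV \<and> length ss \<le> 2 * m + k}"
    using special_length_le by (fastforce simp: special_def)
qed

end

theory Submission
  imports Defs
begin

text \<open>
  Removing the first step of a path (the first two steps when they form a peak) gives
  \<open>E\<^sub>k\<^sub>,\<^sub>i(N) = q\<^sup>N E\<^sub>k\<^sub>,\<^sub>i\<^sub>+\<^sub>1(N) + q\<^sup>N \<Gamma>\<^sub>k\<^sub>,\<^sub>i\<^sub>-\<^sub>1(N)\<close> for \<open>i < k\<close>, the same with \<open>E\<^sub>k\<^sub>,\<^sub>k\<close> in place of \<open>E\<^sub>k\<^sub>,\<^sub>k\<^sub>+\<^sub>1\<close>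
  for \<open>i = k\<close>, and \<open>\<Gamma>\<^sub>k\<^sub>,\<^sub>i(N) = q\<^sup>N \<Gamma>\<^sub>k\<^sub>,\<^sub>i\<^sub>-\<^sub>1(N) + (a + q\<^sup>N\<^sup>-\<^sup>1) E\<^sub>k\<^sub>,\<^sub>i\<^sub>+\<^sub>1(N - 1)\<close>. Together with
  \<open>\<Gamma>\<^sub>k\<^sub>,\<^sub>0 = 0\<close> and \<open>E\<^sub>k\<^sub>,\<^sub>i(0) = 1\<close> these determine both families, and the closed forms satisfy them
  term by term, using \<open>(q)\<^sub>m = (1 - q\<^sup>m) (q)\<^sub>m\<^sub>-\<^sub>1\<close> and the symmetries \<open>n \<mapsto> -n\<close> and \<open>n \<mapsto> -n - 1\<close>.
\<close>

section \<open>Recursive description of paths\<close>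

text \<open>
  The argument \<open>p\<close> is the step before the current one; at the start of a path it is
  \<^const>\<open>SouthEast\<close>, which forbids an initial South step and allows the empty path.
\<close>

fun special_from :: "int \<Rightarrow> int \<Rightarrow> step \<Rightarrow> step list \<Rightarrow> bool" where
  "special_from k h p [] \<longleftrightarrow> h = 0 \<and> h < k \<and> (p = SouthEast \<or> p = South)"
| "special_from k h p (s # ss) \<longleftrightarrow> 0 \<le> h \<and> h < k \<and> (s = East \<longrightarrow> h = 0) \<and>
     (s = South \<longrightarrow> p = NorthEast) \<and> special_from k (h + dy s) s ss"

fun npeaks_from :: "step \<Rightarrow> step list \<Rightarrow> nat" where
  "npeaks_from p [] = 0"
| "npeaks_from p (s # ss) =
     (if p = NorthEast \<and> (s = South \<or> s = SouthEast) then 1 else 0) + npeaks_from s ss"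

fun maj_from :: "nat \<Rightarrow> step \<Rightarrow> step list \<Rightarrow> nat" where
  "maj_from x p [] = 0"
| "maj_from x p (s # ss) =
     (if p = NorthEast \<and> (s = South \<or> s = SouthEast) then x else 0) + maj_from (x + dx s) s ss"

section \<open>Agreement of the recursive functions with the vertex-based ones\<close>

lemma vy_0 [simp]: "vy (h, ss) 0 = h"
  by (simp add: vy_def)

lemma vy_Cons_Suc [simp]: "vy (h, s # ss) (Suc j) = vy (h + dy s, ss) j"
  by (simp add: vy_def)

lemma All_le_Suc2: "(\<forall>j\<le>Suc n. P j) \<longleftrightarrow> P 0 \<and> (\<forall>j\<le>n. P (Suc j))"
  by (simp flip: less_Suc_eq_le add: All_less_Suc2)

text \<open>In \<open>p # ss\<close> the entry at \<open>j\<close> is the step before step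
  \<open>j\<close>, so neither the South condition nor the end condition needs a case of its own for
  the start or the empty list.\<close>

lemma special_from_iff:
  "special_from k h p ss \<longleftrightarrow>
     (\<forall>j\<le>length ss. 0 \<le> vy (h, ss) j) \<and> vy (h, ss) (length ss) = 0 \<and>
     (\<forall>j<length ss. ss ! j = East \<longrightarrow> vy (h, ss) j = 0) \<and>
     (\<forall>j<length ss. ss ! j = South \<longrightarrow> (p # ss) ! j = NorthEast) \<and>
     (last (p # ss) = SouthEast \<or> last (p # ss) = South) \<and>
     (\<forall>j\<le>length ss. vy (h, ss) j < k)"
proof (induction ss arbitrary: h p)
  case (Cons s ss)
  show ?case
    unfolding special_from.simps Cons.IH by (simp add: All_le_Suc2 All_less_Suc2) blast
qed auto

lemma special_iff:
  "special k i (h, ss) \<longleftrightarrow> h = int k - int i \<and> special_from (int k) h SouthEast ss"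
proof -
  have "(SouthEast # ss) ! j = NorthEast \<longleftrightarrow> 0 < j \<and> ss ! (j - 1) = NorthEast" for j
    by (simp add: nth_Cons')
  then show ?thesis
    unfolding special_def lattice_path_def Let_def special_from_iff by auto
qed

definition peaks_from :: "step \<Rightarrow> step list \<Rightarrow> nat set" where
  "peaks_from p ss =
     {j. j < length ss \<and> (p # ss) ! j = NorthEast \<and> (ss ! j = South \<or> ss ! j = SouthEast)}"

lemma finite_peaks_from [simp]: "finite (peaks_from p ss)"
  by (simp add: peaks_from_def)

lemma peaks_from_Cons:
  "peaks_from p (s # ss) =
     (if p = NorthEast \<and> (s = South \<or> s = SouthEast) then {0} else {}) \<union> Suc ` peaks_from s ss"
proof (rule set_eqI)
  fix j
  show "j \<in> peaks_from p (s # ss) \<longleftrightarrow> j \<in> (if p = NorthEast \<and> (s = South \<or> s = SouthEast)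
    then {0} else {}) \<union> Suc ` peaks_from s ss"
    by (cases j) (auto simp: peaks_from_def)
qed

lemma peaks_eq: "peaks (h, ss) = peaks_from SouthEast ss"
  by (auto simp: peaks_def peaks_from_def nth_Cons' split: if_splits)

lemma card_peaks_from: "card (peaks_from p ss) = npeaks_from p ss"
proof (induction ss arbitrary: p)
  case Nil
  then show ?case by (simp add: peaks_from_def)
next
  case (Cons s ss)
  have "card (peaks_from p (s # ss)) =
    (if p = NorthEast \<and> (s = South \<or> s = SouthEast) then 1 else 0) + card (peaks_from s ss)"
    unfolding peaks_from_Cons by (subst card_Un_disjoint) (auto simp: card_image)
  then show ?case by (simp add: Cons.IH)
qed

lemma maj_from_eq: "(\<Sum>j\<in>peaks_from p ss. x + vx (h, ss) j) = maj_from x p ss"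
proof (induction ss arbitrary: p x)
  case Nil
  then show ?case by (simp add: peaks_from_def)
next
  case (Cons s ss)
  have "(\<Sum>j\<in>peaks_from p (s # ss). x + vx (h, s # ss) j) =
    (if p = NorthEast \<and> (s = South \<or> s = SouthEast) then x else 0) +
    (\<Sum>j\<in>peaks_from s ss. x + dx s + vx (h, ss) j)"
    unfolding peaks_from_Cons
    by (subst sum.union_disjoint) (auto simp: sum.reindex vx_def add.assoc)
  then show ?case by (simp add: Cons.IH)
qed

lemma card_peaks_eq: "card (peaks (h, ss)) = npeaks_from SouthEast ss"
  by (simp add: peaks_eq card_peaks_from)

lemma maj_eq: "maj (h, ss) = maj_from 0 SouthEast ss"
  using maj_from_eq[of 0 h ss SouthEast] by (simp add: maj_def peaks_eq)

text \<open>Moving a path right by \<open>d\<close> moves each peak by \<open>d\<close>; hence the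
  powers \<open>q ^ N\<close> in the recurrences.\<close>

lemma maj_from_shift: "maj_from (x + d) p ss = maj_from x p ss + d * npeaks_from p ss"
proof (induction ss arbitrary: p x)
  case (Cons s ss)
  have "maj_from (x + d + dx s) s ss = maj_from (x + dx s) s ss + d * npeaks_from s ss"
    using Cons.IH[of "x + dx s" s] by (simp add: ac_simps)
  then show ?case by auto
qed simp

lemma maj_from_Suc: "maj_from (Suc x) p ss = maj_from x p ss + npeaks_from p ss"
  using maj_from_shift[of x 1] by simp

lemma npeaks_from_South_East:
  "npeaks_from South ss = npeaks_from SouthEast ss" "npeaks_from East ss = npeaks_from SouthEast ss"
  by (cases ss; simp)+

lemma maj_from_South_East:
  "maj_from x South ss = maj_from x SouthEast ss" "maj_from x East ss = maj_from x SouthEast ss"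
  by (cases ss; simp)+

lemma special_from_South: "special_from k h South ss = special_from k h SouthEast ss"
  by (cases ss) auto

lemma special_from_East:
  "special_from k h East ss \<longleftrightarrow> ss \<noteq> [] \<and> special_from k h SouthEast ss"
  by (cases ss) auto

lemma from_NorthEast: "ss \<noteq> [] \<Longrightarrow> hd ss = NorthEast \<Longrightarrow>
   npeaks_from NorthEast ss = npeaks_from SouthEast ss \<and>
   maj_from x NorthEast ss = maj_from x SouthEast ss"
  by (cases ss) auto

section \<open>Generating functions of path sets\<close>

lemma path_gf_empty [simp]: "path_gf (a :: 'a::field) {} = 0"
proof -
  have "Abs_fps (\<lambda>m. 0) = (0 :: 'a fps)" by (simp add: fps_eq_iff)
  then show ?thesis by (simp add: path_gf_def)
qed

lemma path_gf_Un:
  assumes "A \<inter> B = {}" "\<And>m. finite {P\<in>A. maj P = m}" "\<And>m. finite {P\<in>B. maj P = m}"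
  shows "path_gf a (A \<union> B) = path_gf a A + path_gf a B"
proof -
  have "(\<Sum>P\<in>{P\<in>A \<union> B. maj P = m}. a ^ souths P) =
     (\<Sum>P\<in>{P\<in>A. maj P = m}. a ^ souths P) + (\<Sum>P\<in>{P\<in>B. maj P = m}. a ^ souths P)" for m
  proof -
    have "{P\<in>A \<union> B. maj P = m} = {P\<in>A. maj P = m} \<union> {P\<in>B. maj P = m}" by auto
    then show ?thesis
      using assms by (simp only:) (rule sum.union_disjoint, auto)
  qed
  then have "Abs_fps (\<lambda>m. \<Sum>P\<in>{P\<in>A \<union> B. maj P = m}. a ^ souths P) =
     Abs_fps (\<lambda>m. \<Sum>P\<in>{P\<in>A. maj P = m}. a ^ souths P) +
     Abs_fps (\<lambda>m. \<Sum>P\<in>{P\<in>B. maj P = m}. a ^ souths P)"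
    by (simp add: fps_eq_iff)
  then show ?thesis by (simp add: path_gf_def)
qed

text \<open>The fibre of \<open>maj\<close> over \<open>m\<close> in the image is the image of the
  fibre over \<open>m - d\<close>, and empty for \<open>m < d\<close>.\<close>

lemma path_gf_image:
  assumes inj: "inj_on f A"
    and maj: "\<And>P. P \<in> A \<Longrightarrow> maj (f P) = maj P + d"
    and souths: "\<And>P. P \<in> A \<Longrightarrow> souths (f P) = souths P + e"
  shows "path_gf a (f ` A) = fls_const a ^ e * q ^ d * path_gf a A"
proof -
  have "(\<Sum>P\<in>{P\<in>f ` A. maj P = m}. a ^ souths P) =
      (if m < d then 0 else a ^ e * (\<Sum>P\<in>{P\<in>A. maj P = m - d}. a ^ souths P))" for m
  proof (cases "m < d")
    case True
    then have "{P\<in>f ` A. maj P = m} = {}" using maj by auto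
    with True show ?thesis by (simp only:) simp
  next
    case False
    then have "{P\<in>f ` A. maj P = m} = f ` {P\<in>A. maj P = m - d}" using maj by auto
    moreover have "inj_on f {P\<in>A. maj P = m - d}" using inj by (rule inj_on_subset) auto
    ultimately have "(\<Sum>P\<in>{P\<in>f ` A. maj P = m}. a ^ souths P) =
        (\<Sum>P\<in>{P\<in>A. maj P = m - d}. a ^ souths (f P))"
      by (simp add: sum.reindex)
    also have "\<dots> = a ^ e * (\<Sum>P\<in>{P\<in>A. maj P = m - d}. a ^ souths P)"
      unfolding sum_distrib_left
      by (rule sum.cong) (auto simp: souths power_add)
    finally show ?thesis using False by simp
  qed
  then have "Abs_fps (\<lambda>m. \<Sum>P\<in>{P\<in>f ` A. maj P = m}. a ^ souths P) =
      fps_const (a ^ e) * (fps_X ^ d * Abs_fps (\<lambda>m. \<Sum>P\<in>{P\<in>A. maj P = m}. a ^ souths P))"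
    by (auto simp: fps_eq_iff fps_X_power_mult_nth)
  then show ?thesis
    by (simp add: path_gf_def fls_times_fps_to_fls fps_to_fls_power fls_const_power mult.assoc)
qed

section \<open>First-step recurrences\<close>

definition spaths :: "nat \<Rightarrow> nat \<Rightarrow> nat \<Rightarrow> path set" where
  "spaths k i N = {P. special k i P \<and> card (peaks P) = N}"

text \<open>The index is that of the special condition, so \<open>Gamma_bar a k i N\<close> belongs
  to \<open>upaths k (i + 1) N\<close>.\<close>

definition upaths :: "nat \<Rightarrow> nat \<Rightarrow> nat \<Rightarrow> path set" where
  "upaths k i N = {P. special k i P \<and> card (peaks P) = N \<and>
                      snd P \<noteq> [] \<and> hd (snd P) = NorthEast}"

lemma mem_spaths: "(h, ss) \<in> spaths k i N \<longleftrightarrow>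
   h = int k - int i \<and> special_from (int k) h SouthEast ss \<and> npeaks_from SouthEast ss = N"
  by (auto simp: spaths_def special_iff card_peaks_eq)

lemma mem_upaths: "(h, ss) \<in> upaths k i N \<longleftrightarrow>
   h = int k - int i \<and> special_from (int k) h SouthEast ss \<and> npeaks_from SouthEast ss = N \<and>
   ss \<noteq> [] \<and> hd ss = NorthEast"
  by (auto simp: upaths_def special_iff card_peaks_eq)

lemma finite_maj_subset:
  assumes "A \<subseteq> {P. special k i P}"
  shows "finite {P\<in>A. maj P = m}"
  by (rule finite_subset[OF _ finite_special_maj[of k i m]]) (use assms in auto)

lemma spaths_special: "spaths k i N \<subseteq> {P. special k i P}"
  by (auto simp: spaths_def)

lemma upaths_special: "upaths k i N \<subseteq> {P. special k i P}"
  by (auto simp: upaths_def)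

text \<open>In every use \<open>d\<close> is minus the total rise of \<open>us\<close>, so that
  \<open>us\<close> leads to the old starting height.\<close>

definition prepend :: "int \<Rightarrow> step list \<Rightarrow> path \<Rightarrow> path" where
  "prepend d us P = (fst P + d, us @ snd P)"

lemma inj_prepend: "inj_on (prepend d us) A"
  by (auto simp: inj_on_def prepend_def prod_eq_iff)

lemma souths_prepend: "souths (prepend d us P) = souths P + length (filter (\<lambda>s. s = South) us)"
  by (simp add: souths_def prepend_def)

lemma mem_prepend_image: "(h, ss) \<in> prepend d us ` A \<longleftrightarrow> (\<exists>ts. ss = us @ ts \<and> (h - d, ts) \<in> A)"
  by (force simp: prepend_def image_iff)

text \<open>The start height \<open>k - i\<close> is positive, so the path is nonempty and cannot
  open with East. Removing a SouthEast step leaves a path from height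
  \<open>k - (i + 1)\<close>.\<close>

lemma spaths_step:
  assumes "1 \<le> i" "i < k"
  shows "spaths k i N = prepend 1 [SouthEast] ` spaths k (i + 1) N \<union> upaths k i N"
proof (rule set_eqI, clarify)
  fix h ss
  show "(h, ss) \<in> spaths k i N \<longleftrightarrow>
        (h, ss) \<in> prepend 1 [SouthEast] ` spaths k (i + 1) N \<union> upaths k i N"
  proof (cases ss)
    case Nil
    then show ?thesis using assms by (auto simp: mem_spaths mem_upaths mem_prepend_image)
  next
    case (Cons s ts)
    have "0 \<le> h" if "special_from (int k) (h - 1) SouthEast ts"
      using that by (cases ts) auto
    then show ?thesis using assms unfolding Cons Un_iff mem_spaths mem_upaths mem_prepend_image
      by (cases s) auto
  qed
qed

text \<open>From height 0 only East and NorthEast are possible, and East keeps the height, so the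
  same path set recurs.\<close>

lemma spaths_step_0:
  assumes "N \<ge> 1"
  shows "spaths k k N = prepend 0 [East] ` spaths k k N \<union> upaths k k N"
proof (rule set_eqI, clarify)
  fix h ss
  show "(h, ss) \<in> spaths k k N \<longleftrightarrow>
        (h, ss) \<in> prepend 0 [East] ` spaths k k N \<union> upaths k k N"
  proof (cases ss)
    case Nil
    then show ?thesis using assms by (auto simp: mem_spaths mem_upaths mem_prepend_image)
  next
    case (Cons s ts)
    have "h < int k" if "special_from (int k) h SouthEast ts"
      using that by (cases ts) auto
    moreover have "\<not> special_from (int k) (- 1) SouthEast ts" by (cases ts) auto
    \<comment> \<open>A path may not end with East; having a peak keeps the tail nonempty.\<close>
    moreover have "ts \<noteq> []" if "npeaks_from SouthEast ts = N" using that assms by auto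
    ultimately show ?thesis unfolding Cons Un_iff mem_spaths mem_upaths mem_prepend_image
      by (cases s) (auto simp: special_from_East npeaks_from_South_East)
  qed
qed

text \<open>After the first step the height is positive, which excludes East. If NorthEast follows,
  the first step is removed; if SouthEast or South follows, a peak is complete, and removing both
  steps leaves an arbitrary path from the same height with one peak fewer.\<close>

lemma upaths_step:
  assumes "1 \<le> i" "i < k"
  shows "upaths k (i + 1) (Suc N) = prepend (- 1) [NorthEast] ` upaths k i (Suc N) \<union>
     (prepend 0 [NorthEast, SouthEast] ` spaths k (i + 1) N \<union>
      prepend 0 [NorthEast, South] ` spaths k (i + 1) N)"
proof (rule set_eqI, clarify)
  fix h ss
  show "(h, ss) \<in> upaths k (i + 1) (Suc N) \<longleftrightarrow>
    (h, ss) \<in> prepend (- 1) [NorthEast] ` upaths k i (Suc N) \<union>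
     (prepend 0 [NorthEast, SouthEast] ` spaths k (i + 1) N \<union>
      prepend 0 [NorthEast, South] ` spaths k (i + 1) N)"
  proof (cases "\<exists>t ts. ss = NorthEast # t # ts")
    case False
    then have "(h, ss) \<notin> upaths k (i + 1) (Suc N)"
      by (cases ss; cases "tl ss") (auto simp: mem_upaths)
    moreover have "(h, ss) \<notin> prepend (- 1) [NorthEast] ` upaths k i (Suc N)"
      using False by (auto simp: mem_upaths mem_prepend_image neq_Nil_conv)
    ultimately show ?thesis using False by (auto simp: mem_prepend_image)
  next
    case True
    then obtain t ts where ss: "ss = NorthEast # t # ts" by blast
    show ?thesis using assms unfolding ss Un_iff mem_spaths mem_upaths mem_prepend_image
      by (cases t) (auto simp: special_from_South npeaks_from_South_East)
  qed
qed

text \<open>A NorthEast step from height \<open>k - 1\<close> would reach the forbidden height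
  \<open>k\<close>.\<close>

lemma upaths_Suc_0: "upaths k (Suc 0) N = {}"
proof -
  have "(h, ss) \<notin> upaths k (Suc 0) N" for h ss
  proof
    assume "(h, ss) \<in> upaths k (Suc 0) N"
    then obtain ts where "h = int k - 1" "special_from (int k) h SouthEast (NorthEast # ts)"
      by (cases ss) (auto simp: mem_upaths)
    then show False by (cases ts) auto
  qed
  then show ?thesis by auto
qed

section \<open>Paths without peaks\<close>

lemma special_from_nonneg: "special_from k h p ss \<Longrightarrow> 0 \<le> h"
  by (cases ss) auto

text \<open>An ascent would have to turn into a descent at a peak, and an East step would need a
  later ascent. The claims about \<open>p\<close>, applied to the tail, exclude both as the step
  \<open>s\<close>.\<close>

lemma special_from_no_peaks:
  "special_from k h p ss \<Longrightarrow> npeaks_from p ss = 0 \<Longrightarrow>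
   p \<noteq> NorthEast \<and> (p = East \<longrightarrow> 0 < h) \<and> ss = replicate (nat h) SouthEast"
proof (induction ss arbitrary: h p)
  case (Cons s ss)
  have IH: "s \<noteq> NorthEast \<and> (s = East \<longrightarrow> 0 < h + dy s) \<and> ss = replicate (nat (h + dy s)) SouthEast"
    using Cons.IH[of "h + dy s" s] Cons.prems by (auto split: if_splits)
  then have s: "s = SouthEast"
    using Cons.prems by (cases s) auto
  then have "0 < h" using Cons.prems special_from_nonneg[of k "h - 1" s ss] by simp
  then have "nat h = Suc (nat (h - 1))" by simp
  then show ?case using IH Cons.prems s \<open>0 < h\<close> by auto
qed auto

lemma special_from_replicate:
  "int n < k \<Longrightarrow> special_from k (int n) SouthEast (replicate n SouthEast)"
  by (induction n) auto

lemma npeaks_from_replicate: "npeaks_from SouthEast (replicate n SouthEast) = 0"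
  by (induction n) auto

lemma maj_from_replicate: "maj_from x SouthEast (replicate n SouthEast) = 0"
  by (induction n arbitrary: x) auto

lemma spaths_0:
  assumes "1 \<le> i" "i \<le> k"
  shows "spaths k i 0 = {(int k - int i, replicate (k - i) SouthEast)}"
proof -
  have "(h, ss) \<in> spaths k i 0 \<longleftrightarrow> h = int k - int i \<and> ss = replicate (k - i) SouthEast" for h ss
    using special_from_no_peaks[of "int k" h SouthEast ss] assms
      special_from_replicate[of "k - i" "int k"]
    by (auto simp: mem_spaths npeaks_from_replicate nat_diff_distrib)
  then show ?thesis by auto
qed

lemma upaths_0: "upaths k i 0 = {}"
proof -
  have "(h, ss) \<notin> upaths k i 0" for h ss
    using special_from_no_peaks[of "int k" h SouthEast ss]
    by (cases "nat h") (auto simp: mem_upaths)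
  then show ?thesis by auto
qed

section \<open>Initial values and recurrences of the generating functions\<close>

lemma E_bar_eq: "E_bar a k i N = path_gf a (spaths k i N)"
  by (simp add: E_bar_def spaths_def)

lemma Gamma_bar_eq: "q ^ N * Gamma_bar a k i N = path_gf a (upaths k (i + 1) N)"
proof -
  have "q ^ N * (q powi (- int N) * x) = x" for x :: "'a fls"
    by (simp add: power_int_minus)
  then show ?thesis by (simp add: Gamma_bar_def upaths_def)
qed

lemma E_bar_0:
  assumes "1 \<le> i" "i \<le> k"
  shows "E_bar a k i 0 = 1"
proof -
  have "(\<Sum>P\<in>{P\<in>spaths k i 0. maj P = m}. a ^ souths P) = (if m = 0 then 1 else 0)" for m
  proof -
    have "{P\<in>spaths k i 0. maj P = m} =
        (if m = 0 then {(int k - int i, replicate (k - i) SouthEast)} else {})"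
      by (auto simp: spaths_0[OF assms] maj_eq maj_from_replicate)
    then show ?thesis by (simp add: souths_def)
  qed
  then have "Abs_fps (\<lambda>m. \<Sum>P\<in>{P\<in>spaths k i 0. maj P = m}. a ^ souths P) = 1"
    by (simp add: fps_eq_iff)
  then show ?thesis by (simp add: E_bar_eq path_gf_def)
qed

lemma Gamma_bar_0: "Gamma_bar a k i 0 = 0"
  using Gamma_bar_eq[of 0 a k i] by (simp add: upaths_0)

lemma Gamma_bar_first: "Gamma_bar a k 0 N = 0"
  using Gamma_bar_eq[of N a k 0] by (simp add: upaths_Suc_0)

lemma maj_prepend_level:
  assumes "P \<in> spaths k i N" "s = SouthEast \<or> s = East"
  shows "maj (prepend d [s] P) = maj P + N"
  using assms
  by (cases P) (auto simp: prepend_def maj_eq mem_spaths maj_from_Suc maj_from_South_East)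

lemma E_bar_step:
  assumes "1 \<le> i" "i < k"
  shows "E_bar a k i N = q ^ N * E_bar a k (i + 1) N + q ^ N * Gamma_bar a k (i - 1) N"
proof -
  have "path_gf a (spaths k i N) =
      path_gf a (prepend 1 [SouthEast] ` spaths k (i + 1) N) + path_gf a (upaths k i N)"
    unfolding spaths_step[OF assms]
  proof (rule path_gf_Un)
    show "prepend 1 [SouthEast] ` spaths k (i + 1) N \<inter> upaths k i N = {}"
      by (auto simp: prepend_def mem_upaths)
    show "finite {P \<in> prepend 1 [SouthEast] ` spaths k (i + 1) N. maj P = m}" for m
      by (rule finite_maj_subset[of _ k i]) (use spaths_step[OF assms] spaths_special in blast)
    show "finite {P \<in> upaths k i N. maj P = m}" for m
      by (rule finite_maj_subset[OF upaths_special])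
  qed
  also have "path_gf a (prepend 1 [SouthEast] ` spaths k (i + 1) N) =
      fls_const a ^ 0 * q ^ N * path_gf a (spaths k (i + 1) N)"
    by (rule path_gf_image[OF inj_prepend]) (auto simp: maj_prepend_level souths_prepend)
  also have "path_gf a (upaths k i N) = q ^ N * Gamma_bar a k (i - 1) N"
    using assms by (simp add: Gamma_bar_eq)
  finally show ?thesis by (simp add: E_bar_eq)
qed

text \<open>Although \<open>E_bar a k k N\<close> occurs on both sides, it is determined, since
  \<open>1 - q ^ N\<close> is nonzero.\<close>

lemma E_bar_step_last:
  assumes "1 \<le> k" "1 \<le> N"
  shows "E_bar a k k N = q ^ N * E_bar a k k N + q ^ N * Gamma_bar a k (k - 1) N"
proof -
  note step = spaths_step_0[OF assms(2), of k]
  have "path_gf a (prepend 0 [East] ` spaths k k N \<union> upaths k k N) =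
      path_gf a (prepend 0 [East] ` spaths k k N) + path_gf a (upaths k k N)"
  proof (rule path_gf_Un)
    show "prepend 0 [East] ` spaths k k N \<inter> upaths k k N = {}"
      by (auto simp: prepend_def mem_upaths)
    show "finite {P \<in> prepend 0 [East] ` spaths k k N. maj P = m}" for m
      by (rule finite_maj_subset[of _ k k]) (use step spaths_special in blast)
    show "finite {P \<in> upaths k k N. maj P = m}" for m
      by (rule finite_maj_subset[OF upaths_special])
  qed
  also have "path_gf a (prepend 0 [East] ` spaths k k N) =
      fls_const a ^ 0 * q ^ N * path_gf a (spaths k k N)"
    by (rule path_gf_image[OF inj_prepend]) (auto simp: maj_prepend_level souths_prepend)
  also have "path_gf a (upaths k k N) = q ^ N * Gamma_bar a k (k - 1) N"
    using assms by (simp add: Gamma_bar_eq)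
  finally show ?thesis by (simp add: E_bar_eq flip: step)
qed

text \<open>After cancelling \<open>q ^ Suc N\<close>, the three classes of
  \<open>upaths_step\<close> give the \<open>Gamma_bar\<close> term, the \<open>q ^ N\<close> and
  the \<open>fls_const a\<close>.\<close>

lemma Gamma_bar_step:
  assumes "1 \<le> i" "i < k"
  shows "Gamma_bar a k i (Suc N) =
    q ^ Suc N * Gamma_bar a k (i - 1) (Suc N) + (fls_const a + q ^ N) * E_bar a k (i + 1) N"
proof -
  let ?A = "prepend (- 1) [NorthEast] ` upaths k i (Suc N)"
  let ?B = "prepend 0 [NorthEast, SouthEast] ` spaths k (i + 1) N"
  let ?C = "prepend 0 [NorthEast, South] ` spaths k (i + 1) N"
  have special: "?A \<union> (?B \<union> ?C) \<subseteq> {P. special k (i + 1) P}"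
    unfolding upaths_step[OF assms, symmetric] by (rule upaths_special)
  have "path_gf a (upaths k (i + 1) (Suc N)) = path_gf a ?A + path_gf a (?B \<union> ?C)"
    unfolding upaths_step[OF assms]
  proof (rule path_gf_Un)
    show "?A \<inter> (?B \<union> ?C) = {}"
      by (auto simp: prepend_def mem_upaths)
    show "finite {P \<in> ?A. maj P = m}" "finite {P \<in> ?B \<union> ?C. maj P = m}" for m
      by (rule finite_maj_subset, use special in blast)+
  qed
  also have "path_gf a (?B \<union> ?C) = path_gf a ?B + path_gf a ?C"
  proof (rule path_gf_Un)
    show "?B \<inter> ?C = {}"
      by (auto simp: prepend_def)
    show "finite {P \<in> ?B. maj P = m}" "finite {P \<in> ?C. maj P = m}" for m
      by (rule finite_maj_subset, use special in blast)+
  qed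
  \<comment> \<open>The added step precedes NorthEast and makes no peak; all \<open>Suc N\<close>
    peaks move right by 1.\<close>
  also have "path_gf a ?A = fls_const a ^ 0 * q ^ Suc N * path_gf a (upaths k i (Suc N))"
  proof (rule path_gf_image[OF inj_prepend])
    fix P assume "P \<in> upaths k i (Suc N)"
    then show "maj (prepend (- 1) [NorthEast] P) = maj P + Suc N"
      using from_NorthEast[of "snd P"]
      by (cases P) (auto simp: prepend_def maj_eq mem_upaths maj_from_Suc)
  qed (simp add: souths_prepend)
  \<comment> \<open>The new peak has abscissa 1, and the \<open>N\<close> old ones move right by
    2.\<close>
  also have "path_gf a ?B = fls_const a ^ 0 * q ^ (N + N + 1) * path_gf a (spaths k (i + 1) N)"
  proof (rule path_gf_image[OF inj_prepend])
    fix P assume "P \<in> spaths k (i + 1) N"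
    then show "maj (prepend 0 [NorthEast, SouthEast] P) = maj P + (N + N + 1)"
      by (cases P) (auto simp: prepend_def maj_eq mem_spaths maj_from_Suc)
  qed (simp add: souths_prepend)
  \<comment> \<open>South has no width: the old peaks move right by 1 only.\<close>
  also have "path_gf a ?C = fls_const a ^ 1 * q ^ (N + 1) * path_gf a (spaths k (i + 1) N)"
  proof (rule path_gf_image[OF inj_prepend])
    fix P assume "P \<in> spaths k (i + 1) N"
    then show "maj (prepend 0 [NorthEast, South] P) = maj P + (N + 1)"
      by (cases P) (auto simp: prepend_def maj_eq mem_spaths maj_from_Suc maj_from_South_East
          npeaks_from_South_East)
  qed (simp add: souths_prepend)
  also have "path_gf a (upaths k i (Suc N)) = q ^ Suc N * Gamma_bar a k (i - 1) (Suc N)"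
    using assms by (simp add: Gamma_bar_eq del: power_Suc)
  finally have "q ^ Suc N * Gamma_bar a k i (Suc N) = q ^ Suc N *
     (q ^ Suc N * Gamma_bar a k (i - 1) (Suc N) + (fls_const a + q ^ N) * E_bar a k (i + 1) N)"
    by (simp only: Gamma_bar_eq E_bar_eq) (simp add: algebra_simps power_add)
  moreover have "(q :: 'a fls) ^ Suc N \<noteq> 0" by simp
  ultimately show ?thesis by (simp only: mult_cancel_left) blast
qed

section \<open>The closed forms\<close>

declare fls_X_power_int [simp del]

section \<open>Reciprocal q-factorials and binomial exponents\<close>

lemma one_minus_q_power_neq_0: "1 \<le> m \<Longrightarrow> (1 :: 'a::field fls) - q ^ m \<noteq> 0"
proof
  assume m: "1 \<le> m" and "(1 :: 'a fls) - q ^ m = 0"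
  then have "fls_nth (1 :: 'a fls) 0 = fls_nth (q ^ m) 0" by simp
  with m show False by (simp add: fls_X_power_nth)
qed

lemma qpoch_Suc: "qpoch q (Suc m) = qpoch q m * (1 - q ^ Suc m)"
  by (simp add: qpoch_def)

lemma qpoch_neq_0: "qpoch q m \<noteq> (0 :: 'a::field fls)"
  using one_minus_q_power_neq_0[of "Suc _", where 'a = 'a]
  by (auto simp: qpoch_def)

definition inv_qpoch :: "int \<Rightarrow> 'a::field fls" where
  "inv_qpoch m = (if m < 0 then 0 else 1 / qpoch q (nat m))"

text \<open>At \<open>m = 0\<close> the factor vanishes, in accord with the value 0 at -1, so the
  recursion holds for all integers without boundary cases.\<close>

lemma inv_qpoch_step: "(1 - q powi m) * inv_qpoch m = (inv_qpoch (m - 1) :: 'a::field fls)"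
proof (cases "m \<le> 0")
  case True
  then show ?thesis by (cases "m = 0") (auto simp: inv_qpoch_def)
next
  case False
  then obtain l where l: "m = int (Suc l)"
    by (metis gr0_implies_Suc not_le zero_less_imp_eq_int)
  have "(1 :: 'a fls) - q ^ Suc l \<noteq> 0" by (rule one_minus_q_power_neq_0) simp
  moreover have "(q :: 'a fls) powi m = q ^ Suc l" unfolding l by (rule power_int_of_nat)
  moreover have "nat m = Suc l" "nat (m - 1) = l" "\<not> m < 0" "\<not> m - 1 < 0" using l by auto
  ultimately show ?thesis
    by (simp add: inv_qpoch_def qpoch_Suc qpoch_neq_0 del: power_Suc)
qed

lemma two_binom2: "2 * binom2 n = n * (n - 1)"
  unfolding binom2_def by (rule dvd_mult_div_cancel) simp

lemma binom2_add_1: "binom2 (n + 1) = binom2 n + n"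
  using two_binom2[of n] two_binom2[of "n + 1"] by (simp add: algebra_simps)

lemma binom2_uminus: "binom2 (- n) = binom2 n + n"
  using two_binom2[of n] two_binom2[of "- n"] by (simp add: algebra_simps)

text \<open>With \<open>1 / (q)\<^sub>m = 0\<close> for \<open>m < 0\<close>, both sums may run over \<open>{-N..N}\<close>.\<close>

definition E_sum :: "int \<Rightarrow> int \<Rightarrow> nat \<Rightarrow> 'a::field fls" where
  "E_sum k i N = (\<Sum>n\<in>{- int N..int N}. (- 1) powi n * q powi (k * n ^ 2 + n * (k - i) - binom2 n) *
     inv_qpoch (int N - n) * inv_qpoch (int N + n))"

definition Gamma_sum :: "int \<Rightarrow> int \<Rightarrow> nat \<Rightarrow> 'a::field fls" where
  "Gamma_sum k i N = (\<Sum>n\<in>{- int N..int N}.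
     (- 1) powi n * q powi (k * n ^ 2 + n * (k - i) - binom2 (n + 1)) *
     inv_qpoch (int N - n - 1) * inv_qpoch (int N + n))"

section \<open>Recurrences of the sums\<close>

lemma q_powi_add: "q powi (m + n) = (q powi m * q powi n :: 'a::field fls)"
  by (rule power_int_add) simp

text \<open>Passing from \<open>i\<close> to \<open>i + 1\<close> multiplies the \<open>n\<close>-th
  summand by \<open>q powi (- n)\<close>. The difference has the factor
  \<open>1 - q powi (int N - n)\<close>, which lowers the index of one
  \<open>inv_qpoch\<close>.\<close>

lemma E_sum_step: "E_sum k i N = q ^ N * E_sum k (i + 1) N + (Gamma_sum k (i - 1) N :: 'a::field fls)"
  unfolding E_sum_def Gamma_sum_def sum_distrib_left sum.distrib[symmetric]
proof (rule sum.cong[OF refl])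
  fix n
  define e where "e = k * n ^ 2 + n * (k - i) - binom2 n"
  have e1: "k * n ^ 2 + n * (k - (i + 1)) - binom2 n = e + - n"
    by (simp add: e_def algebra_simps)
  have e2: "k * n ^ 2 + n * (k - (i - 1)) - binom2 (n + 1) = e"
    by (simp add: e_def binom2_add_1 right_diff_distrib distrib_left)
  have "(q :: 'a fls) powi (int N - n) = q ^ N * q powi (- n)"
    using q_powi_add[of "int N" "- n", where 'a = 'a] by simp
  then have r: "inv_qpoch (int N - n - 1) =
      (1 - q ^ N * q powi (- n)) * (inv_qpoch (int N - n) :: 'a fls)"
    using inv_qpoch_step[of "int N - n", where 'a = 'a] by simp
  show "(- 1) powi n * q powi (k * n ^ 2 + n * (k - i) - binom2 n) *
      inv_qpoch (int N - n) * inv_qpoch (int N + n) =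
    q ^ N * ((- 1) powi n * q powi (k * n ^ 2 + n * (k - (i + 1)) - binom2 n) *
      inv_qpoch (int N - n) * inv_qpoch (int N + n)) +
    (- 1) powi n * q powi (k * n ^ 2 + n * (k - (i - 1)) - binom2 (n + 1)) *
      inv_qpoch (int N - n - 1) * (inv_qpoch (int N + n) :: 'a fls)"
    unfolding e1 e2 r q_powi_add e_def[symmetric] by (simp add: algebra_simps)
qed

text \<open>Negating \<open>n\<close> changes the binomial by the difference of the linear terms.
  This mirrors the East step at height 0.\<close>

lemma E_sum_last: "E_sum k (k + 1) N = (E_sum k k N :: 'a::field fls)"
  unfolding E_sum_def
proof (rule sum.reindex_bij_witness[of _ uminus uminus])
  fix n
  have "k * (- n) ^ 2 + - n * (k - k) - binom2 (- n) = k * n ^ 2 + n * (k - (k + 1)) - binom2 n"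
    by (simp add: binom2_uminus)
  then show "(- 1) powi (- n) * q powi (k * (- n) ^ 2 + - n * (k - k) - binom2 (- n)) *
      inv_qpoch (int N - - n) * inv_qpoch (int N + - n) =
    (- 1) powi n * q powi (k * n ^ 2 + n * (k - (k + 1)) - binom2 n) *
      inv_qpoch (int N - n) * (inv_qpoch (int N + n) :: 'a fls)"
    by (simp only:) (simp add: power_int_minus flip: power_int_inverse)
qed auto

text \<open>Passing from \<open>i\<close> to \<open>i - 1\<close> multiplies the \<open>n\<close>-th
  summand by \<open>q powi n\<close>; the factor \<open>1 - q powi (int (Suc N) + n)\<close> lowers
  the other index.\<close>

lemma Gamma_sum_step:
  "Gamma_sum k i (Suc N) = q ^ Suc N * Gamma_sum k (i - 1) (Suc N) + (E_sum k (i + 1) N :: 'a::field fls)"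
proof -
  \<comment> \<open>At the two added indices one argument of \<open>inv_qpoch\<close> is -1.\<close>
  have "E_sum k (i + 1) N = (\<Sum>n\<in>{- int (Suc N)..int (Suc N)}.
     (- 1) powi n * q powi (k * n ^ 2 + n * (k - (i + 1)) - binom2 n) *
     inv_qpoch (int N - n) * (inv_qpoch (int N + n) :: 'a fls))"
    unfolding E_sum_def
  proof (rule sum.mono_neutral_left)
    show "\<forall>n\<in>{- int (Suc N)..int (Suc N)} - {- int N..int N}.
        (- 1) powi n * q powi (k * n ^ 2 + n * (k - (i + 1)) - binom2 n) *
        inv_qpoch (int N - n) * inv_qpoch (int N + n) = (0 :: 'a fls)"
      by (auto simp: inv_qpoch_def)
  qed auto
  then show ?thesis
    unfolding Gamma_sum_def sum_distrib_left
  proof (simp only: sum.distrib[symmetric], intro sum.cong[OF refl])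
    fix n
    define e where "e = k * n ^ 2 + n * (k - i) - binom2 (n + 1)"
    have e1: "k * n ^ 2 + n * (k - (i - 1)) - binom2 (n + 1) = e + n"
      by (simp add: e_def algebra_simps)
    have e2: "k * n ^ 2 + n * (k - (i + 1)) - binom2 n = e"
      by (simp add: e_def binom2_add_1 right_diff_distrib distrib_left)
    have "(q :: 'a fls) powi (int (Suc N) + n) = q ^ Suc N * q powi n"
      unfolding q_powi_add power_int_of_nat ..
    then have r: "inv_qpoch (int N + n) =
        (1 - q ^ Suc N * q powi n) * (inv_qpoch (int (Suc N) + n) :: 'a fls)"
      using inv_qpoch_step[of "int (Suc N) + n", where 'a = 'a] by (simp add: algebra_simps)
    have s: "int (Suc N) - n - 1 = int N - n" by simp
    show "(- 1) powi n * q powi (k * n ^ 2 + n * (k - i) - binom2 (n + 1)) *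
        inv_qpoch (int (Suc N) - n - 1) * inv_qpoch (int (Suc N) + n) =
      q ^ Suc N * ((- 1) powi n * q powi (k * n ^ 2 + n * (k - (i - 1)) - binom2 (n + 1)) *
        inv_qpoch (int (Suc N) - n - 1) * inv_qpoch (int (Suc N) + n)) +
      (- 1) powi n * q powi (k * n ^ 2 + n * (k - (i + 1)) - binom2 n) *
        inv_qpoch (int N - n) * (inv_qpoch (int N + n) :: 'a fls)"
      unfolding e1 e2 r s q_powi_add e_def[symmetric] by (simp add: algebra_simps del: power_Suc)
  qed
qed

text \<open>
  The summands for \<open>n\<close> and \<open>-n - 1\<close> cancel. Antisymmetry of the whole sum would not suffice in
  characteristic 2.
\<close>

lemma Gamma_sum_0: "Gamma_sum k 0 N = (0 :: 'a::field fls)"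
proof -
  define f :: "int \<Rightarrow> 'a fls" where
    "f n = (- 1) powi n * q powi (k * n ^ 2 + n * (k - 0) - binom2 (n + 1)) *
       inv_qpoch (int N - n - 1) * inv_qpoch (int N + n)" for n
  have anti: "f (- n - 1) = - f n" for n
  proof -
    have "binom2 (- n - 1 + 1) = binom2 (n + 1)"
      by (simp add: binom2_uminus binom2_add_1)
    then have "k * (- n - 1) ^ 2 + (- n - 1) * (k - 0) - binom2 (- n - 1 + 1) =
        k * n ^ 2 + n * (k - 0) - binom2 (n + 1)"
      by (simp add: power2_eq_square algebra_simps)
    moreover have "(- 1 :: 'a fls) powi (- n - 1) = - ((- 1) powi n)"
      by (cases "even n") (simp_all add: power_int_minus_one_minus power_int_diff power_int_minus)
    moreover have "int N - (- n - 1) - 1 = int N + n" "int N + (- n - 1) = int N - n - 1" by simp_all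
    ultimately show ?thesis unfolding f_def by (simp only:) simp
  qed
  have "Gamma_sum k 0 N = sum f {- int N..int N}"
    by (simp add: Gamma_sum_def f_def)
  also have "\<dots> = sum f ({- int N..- 1} \<union> {0..int N - 1})"
    by (rule sum.mono_neutral_right) (auto simp: f_def inv_qpoch_def)
  also have "\<dots> = sum f {- int N..- 1} + sum f {0..int N - 1}"
    by (rule sum.union_disjoint) auto
  also have "sum f {0..int N - 1} = (\<Sum>n\<in>{- int N..- 1}. - f n)"
    by (rule sum.reindex_bij_witness[of _ "\<lambda>n. - n - 1" "\<lambda>n. - n - 1"]) (auto simp: anti)
  finally show ?thesis by (simp add: sum_negf)
qed

text \<open>The factor before the sum for \<open>Gamma_bar\<close>; the one for \<open>E_bar\<close>
  is \<open>q ^ N\<close> times this.\<close>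

definition prefactor :: "'a::field \<Rightarrow> nat \<Rightarrow> 'a fls" where
  "prefactor a N = fls_const a ^ N * q powi binom2 (int N) * qpoch (- 1 / fls_const a) N"

text \<open>The new factors \<open>a\<close> and \<open>1 + q ^ N / a\<close> combine to
  \<open>a + q ^ N\<close>, the coefficient in \<open>Gamma_bar_step\<close>.\<close>

lemma prefactor_Suc:
  assumes "a \<noteq> 0"
  shows "prefactor a (Suc N) = q ^ N * (fls_const a + q ^ N) * prefactor a N"
proof -
  have "binom2 (int (Suc N)) = binom2 (int N) + int N"
    using binom2_add_1[of "int N"] by (simp add: add.commute)
  then have "q powi binom2 (int (Suc N)) = q powi binom2 (int N) * (q ^ N :: 'a fls)"
    by (simp add: q_powi_add)
  moreover have "fls_const a * (1 - - 1 / fls_const a * q ^ N) = fls_const a + q ^ N"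
    using assms by (simp add: field_simps)
  ultimately show ?thesis
    unfolding prefactor_def qpoch_def prod.lessThan_Suc
    by (simp add: ac_simps)
qed

text \<open>For each positive number of peaks, \<open>Gamma_bar\<close> is settled by ascending
  \<open>i\<close> from 0, using \<open>E_bar\<close> with one peak fewer, and then
  \<open>E_bar\<close> by descending \<open>i\<close> from \<open>k\<close>.\<close>

lemma closed_forms:
  assumes "a \<noteq> 0"
  shows "(\<forall>i. 1 \<le> i \<and> i \<le> k \<longrightarrow> E_bar a k i N = q ^ N * prefactor a N * E_sum (int k) (int i) N) \<and>
         (\<forall>i<k. Gamma_bar a k i N = prefactor a N * Gamma_sum (int k) (int i) N)"
proof (induction N)
  case 0
  have "E_sum (int k) (int i) 0 = (1 :: 'a fls)" for i
    by (simp add: E_sum_def inv_qpoch_def qpoch_def binom2_def)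
  moreover have "Gamma_sum (int k) (int i) 0 = (0 :: 'a fls)" for i
    by (simp add: Gamma_sum_def inv_qpoch_def)
  ultimately show ?case
    by (simp add: E_bar_0 Gamma_bar_0 prefactor_def qpoch_def binom2_def)
next
  case (Suc N)
  note IH = Suc.IH
  have Gamma: "Gamma_bar a k i (Suc N) = prefactor a (Suc N) * Gamma_sum (int k) (int i) (Suc N)"
    if "i < k" for i
    using that
  proof (induction i)
    case 0
    then show ?case by (simp add: Gamma_bar_first Gamma_sum_0)
  next
    case (Suc i)
    have "E_bar a k (Suc i + 1) N = q ^ N * prefactor a N * E_sum (int k) (int (Suc i) + 1) N"
      using IH Suc.prems by (simp add: add.commute)
    then have "Gamma_bar a k (Suc i) (Suc N) =
        q ^ Suc N * (prefactor a (Suc N) * Gamma_sum (int k) (int i) (Suc N)) +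
        (fls_const a + q ^ N) * (q ^ N * prefactor a N * E_sum (int k) (int (Suc i) + 1) N)"
      using Gamma_bar_step[of "Suc i" k a N] Suc by simp
    also have "\<dots> = prefactor a (Suc N) *
        (q ^ Suc N * Gamma_sum (int k) (int (Suc i) - 1) (Suc N) + E_sum (int k) (int (Suc i) + 1) N)"
      unfolding prefactor_Suc[OF assms] by (simp add: algebra_simps)
    finally show ?case unfolding Gamma_sum_step[of "int k" "int (Suc i)"] .
  qed
  have E: "E_bar a k i (Suc N) = q ^ Suc N * prefactor a (Suc N) * E_sum (int k) (int i) (Suc N)"
    if "1 \<le> i" "i \<le> k" for i
    using that(2,1)
  proof (induction i rule: inc_induct)
    case base
    define M where "M = Suc N"
    have "(1 - q ^ M) * E_bar a k k M = q ^ M * Gamma_bar a k (k - 1) M"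
      using E_bar_step_last[of k M a] base by (simp add: M_def algebra_simps)
    also have "\<dots> = q ^ M * prefactor a M * Gamma_sum (int k) (int k - 1) M"
      using Gamma[of "k - 1"] base by (simp add: M_def)
    \<comment> \<open>By \<open>E_sum_last\<close> the closed form satisfies the same
      self-referential equation as \<open>E_bar a k k M\<close>.\<close>
    also have "Gamma_sum (int k) (int k - 1) M = (1 - q ^ M) * (E_sum (int k) (int k) M :: 'a fls)"
      using E_sum_step[of "int k" "int k" M, where 'a = 'a] unfolding E_sum_last by (simp add: algebra_simps)
    finally have "(1 - q ^ M) * E_bar a k k M =
        (1 - q ^ M) * (q ^ M * prefactor a M * E_sum (int k) (int k) M)"
      by (simp only: ac_simps)
    moreover have "(1 :: 'a fls) - q ^ M \<noteq> 0" by (rule one_minus_q_power_neq_0) (simp add: M_def)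
    ultimately show ?case unfolding M_def by (simp only: mult_cancel_left) blast
  next
    case (step i)
    have "E_bar a k i (Suc N) =
        q ^ Suc N * (q ^ Suc N * prefactor a (Suc N) * E_sum (int k) (int i + 1) (Suc N)) +
        q ^ Suc N * (prefactor a (Suc N) * Gamma_sum (int k) (int i - 1) (Suc N))"
      using E_bar_step[of i k a "Suc N"] step Gamma[of "i - 1"] by (simp add: of_nat_diff add.commute)
    then show ?case
      unfolding E_sum_step[of "int k" "int i" "Suc N"] by (simp only: algebra_simps)
  qed
  show ?case using E Gamma by blast
qed

theorem theorem3p2:
  fixes a :: "'a::field" and k N :: nat
  assumes "a \<noteq> 0" and "k \<ge> 1"
  shows "(\<forall>i. 1 \<le> i \<and> i \<le> k \<longrightarrow>
           E_bar a k i N =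
             fls_const a ^ N * q powi binom2 (int N + 1) * qpoch (- 1 / fls_const a) N *
             (\<Sum>n\<in>{- int N..int N}.
                (-1) powi n *
                (q powi (int k * n ^ 2 + n * (int k - int i) - binom2 n) /
                 (qpoch q (nat (int N - n)) * qpoch q (nat (int N + n)))))) \<and>
         (\<forall>i. 0 \<le> i \<and> i < k \<longrightarrow>
           Gamma_bar a k i N =
             fls_const a ^ N * q powi binom2 (int N) * qpoch (- 1 / fls_const a) N *
             (\<Sum>n\<in>{- int N..int N - 1}.
                (-1) powi n *
                (q powi (int k * n ^ 2 + n * (int k - int i) - binom2 (n + 1)) /
                 (qpoch q (nat (int N - n - 1)) * qpoch q (nat (int N + n))))))"
proof -
  have pre: "q ^ N * prefactor a N =
      fls_const a ^ N * q powi binom2 (int N + 1) * qpoch (- 1 / fls_const a) N"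
    by (simp add: prefactor_def binom2_add_1 q_powi_add)
  have E: "E_sum (int k) (int i) N = (\<Sum>n\<in>{- int N..int N}.
      (-1) powi n * (q powi (int k * n ^ 2 + n * (int k - int i) - binom2 n) /
        (qpoch q (nat (int N - n)) * qpoch q (nat (int N + n)))) :: 'a fls)" for i
    unfolding E_sum_def by (rule sum.cong) (auto simp: inv_qpoch_def)
  have G: "Gamma_sum (int k) (int i) N = (\<Sum>n\<in>{- int N..int N - 1}.
      (-1) powi n * (q powi (int k * n ^ 2 + n * (int k - int i) - binom2 (n + 1)) /
        (qpoch q (nat (int N - n - 1)) * qpoch q (nat (int N + n)))) :: 'a fls)" for i
    \<comment> \<open>The extra summand at \<open>n = int N\<close> contains
      \<open>inv_qpoch (- 1) = 0\<close>.\<close>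
    unfolding Gamma_sum_def by (rule sum.mono_neutral_cong_right) (auto simp: inv_qpoch_def)
  show ?thesis
    using closed_forms[OF assms(1), of k N] unfolding pre E G by (simp add: prefactor_def)
qed

end
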